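(* Let $G$ be a connected graph of order $n\ge 3$. Then $rx_3(G)=2$ if and only if $G$ is isomorphic to $K_5$, or $G$ is a $2$-connected graph of order $4$, or $G$ has order $3$.
   Context: All graphs are finite, simple and undirected. Edge-colorings are arbitrary maps from $E(G)$ to a finite set of colors (adjacent edges may receive the same color). A tree $T$ that is a subgraph of an edge-colored graph $G$ is a rainbow tree if no two edges of $T$ have the same color. For $S\subseteq V(G)$, a rainbow $S$-tree is a rainbow tree in $G$ whose vertex set contains $S$ (it may contain other vertices). For a connected graph $G$ of order at least $3$, $rx_3(G)$ (the $3$-rainbow index) is the minimum number of colors in an edge-coloring of $G$ such that for every $3$-element subset $S$ of $V(G)$ there is a rainbow $S$-tree. The order of a graph is its number of vertices. *)

theory Defs
  imports Main
begin

record 'a graph =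
  verts :: "'a set"
  edges :: "'a set set"

definition simple_graph :: "'a graph \<Rightarrow> bool" where
  "simple_graph G \<longleftrightarrow> finite (verts G) \<and> (\<forall>e\<in>edges G. e \<subseteq> verts G \<and> card e = 2)"

definition adjacent :: "'a graph \<Rightarrow> 'a \<Rightarrow> 'a \<Rightarrow> bool" where
  "adjacent G u v \<longleftrightarrow> {u, v} \<in> edges G"

definition walk :: "'a graph \<Rightarrow> 'a list \<Rightarrow> bool" where
  "walk G p \<longleftrightarrow> p \<noteq> [] \<and> set p \<subseteq> verts G \<and> successively (adjacent G) p"

definition connected_graph :: "'a graph \<Rightarrow> bool" where
  "connected_graph G \<longleftrightarrow> verts G \<noteq> {} \<and>
     (\<forall>u\<in>verts G. \<forall>v\<in>verts G. \<exists>p. walk G p \<and> hd p = u \<and> last p = v)"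

text \<open>A cycle is given by the list of its vertices in cyclic order, without repeating the first.\<close>

definition cycle :: "'a graph \<Rightarrow> 'a list \<Rightarrow> bool" where
  "cycle G p \<longleftrightarrow> walk G p \<and> distinct p \<and> length p \<ge> 3 \<and> adjacent G (last p) (hd p)"

definition tree :: "'a graph \<Rightarrow> bool" where
  "tree T \<longleftrightarrow> simple_graph T \<and> connected_graph T \<and> (\<nexists>p. cycle T p)"

definition subgraph :: "'a graph \<Rightarrow> 'a graph \<Rightarrow> bool" where
  "subgraph H G \<longleftrightarrow> simple_graph H \<and> verts H \<subseteq> verts G \<and> edges H \<subseteq> edges G"

definition delete_verts :: "'a graph \<Rightarrow> 'a set \<Rightarrow> 'a graph" where
  "delete_verts G X = \<lparr>verts = verts G - X, edges = {e \<in> edges G. e \<inter> X = {}}\<rparr>"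

definition k_connected :: "nat \<Rightarrow> 'a graph \<Rightarrow> bool" where
  "k_connected k G \<longleftrightarrow> card (verts G) > k \<and>
     (\<forall>X. X \<subseteq> verts G \<and> card X < k \<longrightarrow> connected_graph (delete_verts G X))"

definition complete_graph :: "nat \<Rightarrow> nat graph" where
  "complete_graph n = \<lparr>verts = {0..<n}, edges = {e. e \<subseteq> {0..<n} \<and> card e = 2}\<rparr>"

definition graph_isomorphic :: "'a graph \<Rightarrow> 'b graph \<Rightarrow> bool" where
  "graph_isomorphic G H \<longleftrightarrow> (\<exists>f. bij_betw f (verts G) (verts H) \<and>
     (\<forall>u\<in>verts G. \<forall>v\<in>verts G. adjacent G u v \<longleftrightarrow> adjacent H (f u) (f v)))"

text \<open>Colors are natural numbers, which is no restriction since only finitely many are used.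
  Only the values of a coloring on the edges of the graph matter.\<close>

definition rainbow_S_tree :: "'a graph \<Rightarrow> ('a set \<Rightarrow> nat) \<Rightarrow> 'a set \<Rightarrow> 'a graph \<Rightarrow> bool" where
  "rainbow_S_tree G c S T \<longleftrightarrow> subgraph T G \<and> tree T \<and> inj_on c (edges T) \<and> S \<subseteq> verts T"

definition three_rainbow_coloring :: "'a graph \<Rightarrow> ('a set \<Rightarrow> nat) \<Rightarrow> bool" where
  "three_rainbow_coloring G c \<longleftrightarrow>
     (\<forall>S. S \<subseteq> verts G \<and> card S = 3 \<longrightarrow> (\<exists>T. rainbow_S_tree G c S T))"

text \<open>For a connected simple graph the minimum is attained: a coloring that is injective on
  the edges qualifies, since a spanning tree is then rainbow.\<close>

definition rx3 :: "'a graph \<Rightarrow> nat" where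
  "rx3 G = (LEAST k. \<exists>c. three_rainbow_coloring G c \<and> card (c ` edges G) = k)"

end

theory Submission
  imports Defs
begin

text \<open>
  With only two colors available a rainbow tree has at most two edges, so a rainbow tree
  containing three given vertices is a path with two differently colored edges on exactly these
  vertices (\<open>rainbow_S_tree_two_colors_iff\<close>).  Fewer than two colors never suffice, so
  \<open>rx3 G = 2\<close> says that some coloring with two colors puts such a bicolored path on every triple
  (\<open>rx3_eq_2_iff\<close>).

  Given such a coloring, let \<open>A\<close> and \<open>B\<close> be its color classes; every triple contains a pair from
  \<open>A\<close> and a pair from \<open>B\<close>.  Two vertices that are not joined to \<open>v\<close> by \<open>A\<close> must be joined to each
  other by \<open>A\<close>.  Three such vertices would therefore form a triple inside \<open>A\<close>, which misses \<open>B\<close>.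
  Hence at most two vertices are not \<open>A\<close>-neighbors of \<open>v\<close>, and at most two are not
  \<open>B\<close>-neighbors.  Since \<open>A\<close> and \<open>B\<close> are disjoint, every other vertex is of one of the two kinds,
  and a non-neighbor of \<open>v\<close> is of both kinds.  So there are at most five vertices, and if there
  are five, no pair is a non-edge (\<open>order_le_5_and_complete\<close>).  If there are four, deleting any
  vertex leaves a triple, which carries a path, so the graph is 2-connected.

  Conversely, color a pentagon in \<open>K\<^sub>5\<close> with one color and the complementary pentagon with the
  other; no triangle is monochromatic.  A 2-connected graph of order four contains a spanning
  4-cycle, because its non-edges form a matching; coloring that cycle alternately works.  A
  connected graph of order three contains a path with two edges, which get different colors.
\<close>

section \<open>Connectivity and cuts\<close>

lemma walk_crosses_cut:
  assumes "walk G p" "hd p \<in> X" "last p \<notin> X"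
  shows "\<exists>u\<in>X. \<exists>v\<in>verts G - X. adjacent G u v"
  using assms
proof (induction p)
  case Nil
  then show ?case by (simp add: walk_def)
next
  case (Cons a p)
  show ?case
  proof (cases "p = []")
    case True
    then show ?thesis using Cons.prems by simp
  next
    case False
    then have w: "walk G p" and a: "adjacent G a (hd p)" and v: "hd p \<in> verts G"
      using Cons.prems(1) by (auto simp: walk_def successively_Cons)
    show ?thesis
      using Cons.IH[OF w] Cons.prems a v False by auto
  qed
qed

text \<open>Finding an edge across a cut is easier than handling walks, both when connectivity is to be
  shown and when it is used.\<close>

lemma connected_graph_iff_cut:
  "connected_graph G \<longleftrightarrow> verts G \<noteq> {} \<and>
     (\<forall>X. X \<subseteq> verts G \<and> X \<noteq> {} \<and> X \<noteq> verts G \<longrightarrow>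
        (\<exists>u\<in>X. \<exists>v\<in>verts G - X. adjacent G u v))"
    (is "?L \<longleftrightarrow> ?R")
proof
  assume L: ?L
  have "\<exists>u\<in>X. \<exists>v\<in>verts G - X. adjacent G u v"
    if X: "X \<subseteq> verts G" "X \<noteq> {}" "X \<noteq> verts G" for X
  proof -
    obtain a b where "a \<in> X" "b \<in> verts G" "b \<notin> X" using X by blast
    moreover from this obtain p where "walk G p" "hd p = a" "last p = b"
      using L X unfolding connected_graph_def by (meson subsetD)
    ultimately show ?thesis using walk_crosses_cut by metis
  qed
  then show ?R using L by (auto simp: connected_graph_def)
next
  assume R: ?R
  have "\<exists>p. walk G p \<and> hd p = u \<and> last p = v" if u: "u \<in> verts G" and v: "v \<in> verts G" for u v
  proof -
    define X where "X = {w. \<exists>p. walk G p \<and> hd p = u \<and> last p = w}"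
    have "walk G [u]" using u by (simp add: walk_def)
    then have uX: "u \<in> X" unfolding X_def by force
    have sub: "X \<subseteq> verts G" by (auto simp: X_def walk_def)
    have closed: "b \<in> X" if ab: "a \<in> X" "b \<in> verts G" "adjacent G a b" for a b
    proof -
      obtain p where "walk G p" "hd p = u" "last p = a" using ab by (auto simp: X_def)
      then have "walk G (p @ [b]) \<and> hd (p @ [b]) = u \<and> last (p @ [b]) = b"
        using ab by (auto simp: walk_def successively_append_iff)
      then show ?thesis unfolding X_def by blast
    qed
    have "X = verts G" using R uX sub closed by blast
    then show ?thesis using v by (auto simp: X_def)
  qed
  then show ?L using R by (auto simp: connected_graph_def)
qed

lemma connected_graph_cutD:
  assumes "connected_graph G" "X \<subseteq> verts G" "X \<noteq> {}" "X \<noteq> verts G"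
  shows "\<exists>u\<in>X. \<exists>v\<in>verts G - X. adjacent G u v"
  using assms by (simp add: connected_graph_iff_cut)

lemma adjacent_commute: "adjacent G u v \<longleftrightarrow> adjacent G v u"
  by (simp add: adjacent_def insert_commute)

lemma simple_graph_not_adjacent_self:
  assumes "simple_graph G"
  shows "\<not> adjacent G u u"
  using assms by (force simp: simple_graph_def adjacent_def)

lemma finite_edges:
  assumes "simple_graph G"
  shows "finite (edges G)"
  by (rule finite_subset[of _ "Pow (verts G)"]) (use assms in \<open>auto simp: simple_graph_def\<close>)

lemma connected_graph_order_3:
  assumes "simple_graph G" "connected_graph G" "card (verts G) = 3"
  obtains x y z where "verts G = {x, y, z}" "distinct [x, y, z]" "{x, y} \<in> edges G" "{y, z} \<in> edges G"
proof -
  obtain a b c where V: "verts G = {a, b, c}" and d: "a \<noteq> b" "b \<noteq> c" "a \<noteq> c"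
    using assms(3) by (auto simp: card_3_iff)
  \<comment> \<open>Each vertex has a neighbor, by the cut around it; in a graph on three vertices this forces
    two edges.\<close>
  have "\<exists>w\<in>verts G - {v}. {v, w} \<in> edges G" if "v \<in> verts G" for v
    using connected_graph_cutD[OF assms(2), of "{v}"] that V d by (auto simp: adjacent_def)
  from this[of a] this[of b] this[of c] V d
  have "{a, b} \<in> edges G \<and> {b, c} \<in> edges G \<or> {b, a} \<in> edges G \<and> {a, c} \<in> edges G \<or>
        {a, c} \<in> edges G \<and> {c, b} \<in> edges G"
    by (auto simp: insert_commute)
  then show thesis
    using that[of a b c] that[of b a c] that[of a c b] V d by (auto simp: insert_commute)
qed

section \<open>Growing trees\<close>

lemma cycle_two_neighbors:
  assumes "cycle G p" "v \<in> set p"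
  obtains a b where "a \<noteq> b" "adjacent G a v" "adjacent G b v"
proof -
  obtain xs ys where p: "p = xs @ v # ys" using assms(2) by (meson split_list)
  have d: "distinct p" and l: "length p \<ge> 3" and s: "successively (adjacent G) p"
    and c: "adjacent G (last p) (hd p)"
    using assms(1) by (auto simp: cycle_def walk_def)
  consider "xs = []" | "xs \<noteq> []" "ys = []" | "xs \<noteq> []" "ys \<noteq> []" by blast
  then show thesis
  proof cases
    case 1
    then obtain a b zs where ys: "ys = a # b # zs"
      using l p by (auto simp: numeral_eq_Suc Suc_le_length_iff)
    show thesis
      by (rule that[of a "last (b # zs)"])
         (use 1 ys d s c p in \<open>auto simp: adjacent_commute successively_Cons\<close>)
  next
    case 2
    then obtain a b zs where xs: "xs = a # b # zs"
      using l p by (auto simp: numeral_eq_Suc Suc_le_length_iff)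
    show thesis
      by (rule that[of a "last (b # zs)"])
         (use 2 xs d s c p in \<open>auto simp: adjacent_commute successively_Cons successively_append_iff\<close>)
  next
    case 3
    show thesis
    proof (rule that[of "last xs" "hd ys"])
      show "last xs \<noteq> hd ys"
        using 3 d p by (metis IntI distinct_append distinct.simps(2) empty_iff hd_in_set last_in_set
            list.set_intros(2))
    qed (use 3 s p in \<open>auto simp: adjacent_commute successively_Cons successively_append_iff\<close>)
  qed
qed

text \<open>No cycle passes through the new vertex, because a vertex on a cycle has two
  neighbors and the new vertex has only one.\<close>

lemma tree_add_leaf:
  assumes T: "tree T" and u: "u \<in> verts T" and v: "v \<notin> verts T"
  shows "tree \<lparr>verts = insert v (verts T), edges = insert {u, v} (edges T)\<rparr>" (is "tree ?T'")
proof -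
  have simple: "simple_graph T" and con: "connected_graph T" and acyclic: "\<nexists>p. cycle T p"
    using T by (auto simp: tree_def)
  have uv: "u \<noteq> v" using u v by blast
  have "simple_graph ?T'"
    using simple u v uv by (auto simp: simple_graph_def)
  moreover have "connected_graph ?T'"
    unfolding connected_graph_iff_cut
  proof (intro conjI allI impI)
    fix X assume X: "X \<subseteq> verts ?T' \<and> X \<noteq> {} \<and> X \<noteq> verts ?T'"
    show "\<exists>a\<in>X. \<exists>b\<in>verts ?T' - X. adjacent ?T' a b"
    proof (cases "X \<inter> verts T = {} \<or> verts T \<subseteq> X")
      case True
      then have "u \<in> X \<and> v \<notin> X \<or> v \<in> X \<and> u \<notin> X" using X u by auto
      then show ?thesis using u by (auto simp: adjacent_def insert_commute)
    next
      case False
      then obtain a b where "a \<in> X \<inter> verts T" "b \<in> verts T - X \<inter> verts T" "adjacent T a b"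
        using connected_graph_cutD[OF con, of "X \<inter> verts T"] by blast
      then show ?thesis by (auto simp: adjacent_def)
    qed
  qed simp
  moreover have "\<not> cycle ?T' p" for p
  proof
    assume p: "cycle ?T' p"
    have leaf: "a = u" if "adjacent ?T' a v" for a
    proof -
      have "{a, v} \<notin> edges T" using simple v by (auto simp: simple_graph_def)
      then show ?thesis using that uv by (auto simp: adjacent_def doubleton_eq_iff)
    qed
    have "v \<notin> set p"
      using cycle_two_neighbors[OF p] leaf by metis
    then have adj: "adjacent T a b" if "a \<in> set p" "b \<in> set p" "adjacent ?T' a b" for a b
      using that by (auto simp: adjacent_def doubleton_eq_iff)
    have "p \<noteq> []" "successively (adjacent ?T') p" "adjacent ?T' (last p) (hd p)"
      using p by (auto simp: cycle_def walk_def)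
    then have "successively (adjacent T) p" "adjacent T (last p) (hd p)"
      using adj by (auto intro: successively_mono)
    then have "cycle T p"
      using p \<open>v \<notin> set p\<close> by (auto simp: cycle_def walk_def)
    then show False using acyclic by blast
  qed
  ultimately show ?thesis by (auto simp: tree_def)
qed

lemma tree_single: "tree \<lparr>verts = {v}, edges = {}\<rparr>"
  by (auto simp: tree_def simple_graph_def connected_graph_iff_cut cycle_def adjacent_def)

lemma tree_path_3:
  assumes "distinct [x, y, z]"
  shows "tree \<lparr>verts = {x, y, z}, edges = {{x, y}, {y, z}}\<rparr>"
  using tree_add_leaf[OF tree_add_leaf[OF tree_single[of y], of y x], of y z] assms
  by (auto simp: insert_commute)

lemma connected_graph_spanning_tree:
  assumes G: "simple_graph G" "connected_graph G"
  obtains T where "subgraph T G" "tree T" "verts T = verts G"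
proof -
  have fin: "finite (verts G)" using G by (simp add: simple_graph_def)
  have ne: "verts G \<noteq> {}" using G by (simp add: connected_graph_def)
  have "\<exists>T. subgraph T G \<and> tree T \<and> card (verts T) = Suc k" if "Suc k \<le> card (verts G)" for k
    using that
  proof (induction k)
    case 0
    obtain v where "v \<in> verts G" using ne by blast
    then show ?case
      by (intro exI[of _ "\<lparr>verts = {v}, edges = {}\<rparr>"])
         (auto simp: tree_single subgraph_def simple_graph_def)
  next
    case (Suc k)
    then obtain T where T: "subgraph T G" "tree T" "card (verts T) = Suc k" by auto
    have VT: "verts T \<subseteq> verts G" using T by (simp add: subgraph_def)
    have "verts T \<noteq> {}" using T(3) by auto
    moreover have "verts T \<noteq> verts G" using T(3) Suc.prems by auto
    ultimately obtain u v where uv: "u \<in> verts T" "v \<in> verts G - verts T" "adjacent G u v"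
      using connected_graph_cutD[OF G(2) VT] by blast
    let ?T = "\<lparr>verts = insert v (verts T), edges = insert {u, v} (edges T)\<rparr>"
    have "tree ?T" using tree_add_leaf[OF T(2)] uv by blast
    moreover have "subgraph ?T G"
      using calculation T(1) uv by (auto simp: subgraph_def tree_def adjacent_def)
    moreover have "card (verts ?T) = Suc (Suc k)"
      using T(3) uv finite_subset[OF VT fin] by simp
    ultimately show ?case by blast
  qed
  from this[of "card (verts G) - 1"] obtain T
    where T: "subgraph T G" "tree T" "card (verts T) = card (verts G)"
    using ne fin by (auto simp: card_gt_0_iff Suc_leI)
  then have "verts T = verts G" using fin by (simp add: card_subset_eq subgraph_def)
  then show thesis using T that by blast
qed

section \<open>Colorings with two colors\<close>

definition bicolored_path :: "'a graph \<Rightarrow> ('a set \<Rightarrow> nat) \<Rightarrow> 'a set \<Rightarrow> bool" where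
  "bicolored_path G c S \<longleftrightarrow> (\<exists>x y z. S = {x, y, z} \<and> distinct [x, y, z] \<and>
     {x, y} \<in> edges G \<and> {y, z} \<in> edges G \<and> c {x, y} \<noteq> c {y, z})"

lemma bicolored_pathI:
  assumes "S = {x, y, z}" "distinct [x, y, z]" "{x, y} \<in> edges G" "{y, z} \<in> edges G"
    "c {x, y} \<noteq> c {y, z}"
  shows "bicolored_path G c S"
  using assms unfolding bicolored_path_def by blast

lemma connected_graph_Union_edges:
  assumes "simple_graph G" "connected_graph G" "card (verts G) \<ge> 2"
  shows "\<Union> (edges G) = verts G"
proof
  show "\<Union> (edges G) \<subseteq> verts G" using assms by (auto simp: simple_graph_def)
  show "verts G \<subseteq> \<Union> (edges G)"
  proof
    fix v assume v: "v \<in> verts G"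
    have "card {v} \<noteq> card (verts G)" using assms(3) by simp
    then have "{v} \<noteq> verts G" by metis
    then show "v \<in> \<Union> (edges G)"
      using connected_graph_cutD[OF assms(2), of "{v}"] v by (auto simp: adjacent_def)
  qed
qed

lemma connected_graph_two_edges:
  assumes "simple_graph G" "connected_graph G" "card (verts G) \<ge> 3"
  shows "card (edges G) \<ge> 2"
proof (rule ccontr)
  assume "\<not> ?thesis"
  then have "edges G = {} \<or> (\<exists>e. edges G = {e})"
    using finite_edges[OF assms(1)] by (metis One_nat_def card_0_eq card_1_singletonE less_2_cases not_le)
  then have "card (\<Union> (edges G)) \<le> 2" using assms(1) by (auto simp: simple_graph_def)
  moreover have "\<Union> (edges G) = verts G" 
    using connected_graph_Union_edges[OF assms(1,2)] assms(3) by linarith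
  ultimately show False using assms(3) by simp
qed

lemma rainbow_S_treeD:
  assumes "simple_graph G" "card S = 3" "rainbow_S_tree G c S T"
  shows "simple_graph T" "connected_graph T" "card (verts T) \<ge> 3" "card (edges T) \<ge> 2"
    "card (edges T) \<le> card (c ` edges G)"
proof -
  have T: "subgraph T G" "tree T" "inj_on c (edges T)" "S \<subseteq> verts T"
    using assms(3) by (auto simp: rainbow_S_tree_def)
  show s: "simple_graph T" and con: "connected_graph T" using T by (auto simp: tree_def)
  show "card (verts T) \<ge> 3"
    using T(4) s assms(2) by (metis card_mono simple_graph_def)
  then show "card (edges T) \<ge> 2" using connected_graph_two_edges[OF s con] by blast
  have "card (edges T) = card (c ` edges T)" using T(3) by (simp add: card_image)
  also have "\<dots> \<le> card (c ` edges G)"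
    using T(1) finite_edges[OF assms(1)] by (intro card_mono image_mono finite_imageI) (auto simp: subgraph_def)
  finally show "card (edges T) \<le> card (c ` edges G)" .
qed

text \<open>A rainbow tree has at most as many edges as there are colors, here two.  To cover three
  vertices it needs two edges, and these share a vertex because the tree is connected.\<close>

lemma rainbow_S_tree_two_colors_iff:
  assumes G: "simple_graph G" and col: "card (c ` edges G) = 2" and S: "card S = 3" "S \<subseteq> verts G"
  shows "(\<exists>T. rainbow_S_tree G c S T) \<longleftrightarrow> bicolored_path G c S"
proof
  assume "\<exists>T. rainbow_S_tree G c S T"
  then obtain T where T: "rainbow_S_tree G c S T" by blast
  note D = rainbow_S_treeD[OF G S(1) T]
  have T': "subgraph T G" "inj_on c (edges T)" "S \<subseteq> verts T"
    using T by (auto simp: rainbow_S_tree_def)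
  obtain e f where ef: "edges T = {e, f}" "e \<noteq> f"
    using D(4,5) col by (metis card_2_iff le_antisym)
  have card: "card e = 2" "card f = 2" using D(1) ef by (auto simp: simple_graph_def)
  have un: "verts T = e \<union> f"
    using connected_graph_Union_edges[OF D(1,2)] D(3) ef by auto
  have "e \<inter> f \<noteq> {}"
  proof
    assume disj: "e \<inter> f = {}"
    have "e \<noteq> {}" "f \<noteq> {}" using card by auto
    then have "e \<noteq> verts T" using un disj by blast
    then obtain u v where "u \<in> e" "v \<in> verts T - e" "adjacent T u v"
      using connected_graph_cutD[OF D(2), of e] un \<open>e \<noteq> {}\<close> by blast
    then show False using un disj ef by (auto simp: adjacent_def)
  qed
  then obtain y where "y \<in> e" "y \<in> f" by blast
  then obtain x z where xz: "e = {x, y}" "f = {y, z}" "x \<noteq> y" "z \<noteq> y"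
    using card by (auto simp: card_2_iff)
  then have d: "distinct [x, y, z]" using ef(2) by auto
  have "S = {x, y, z}"
    using card_subset_eq[of "{x, y, z}" S] T'(3) un xz S(1) d by auto
  moreover have "c {x, y} \<noteq> c {y, z}"
    using T'(2) ef xz by (auto simp: inj_on_def)
  moreover have "{x, y} \<in> edges G" "{y, z} \<in> edges G"
    using T'(1) ef xz by (auto simp: subgraph_def)
  ultimately show "bicolored_path G c S" using d by (intro bicolored_pathI[of S x y z])
next
  assume "bicolored_path G c S"
  then obtain x y z where P: "S = {x, y, z}" "distinct [x, y, z]"
    "{x, y} \<in> edges G" "{y, z} \<in> edges G" "c {x, y} \<noteq> c {y, z}"
    unfolding bicolored_path_def by blast
  have "rainbow_S_tree G c S \<lparr>verts = {x, y, z}, edges = {{x, y}, {y, z}}\<rparr>"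
    using tree_path_3[OF P(2)] P S(2)
    by (auto simp: rainbow_S_tree_def subgraph_def tree_def inj_on_def)
  then show "\<exists>T. rainbow_S_tree G c S T" by blast
qed

text \<open>The minimum defining \<open>rx3\<close> is over a nonempty set, which is where the spanning tree is
  needed: an injective coloring makes it rainbow.  Every member of that set is at least 2.\<close>

lemma rx3_eq_2_iff:
  assumes G: "simple_graph G" "connected_graph G" "card (verts G) \<ge> 3"
  shows "rx3 G = 2 \<longleftrightarrow> (\<exists>c. card (c ` edges G) = 2 \<and>
           (\<forall>S. S \<subseteq> verts G \<and> card S = 3 \<longrightarrow> bicolored_path G c S))"
proof -
  let ?P = "\<lambda>k. \<exists>c. three_rainbow_coloring G c \<and> card (c ` edges G) = k"
  obtain c :: "'a set \<Rightarrow> nat" where c: "inj_on c (edges G)"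
    using finite_imp_inj_to_nat_seg[OF finite_edges[OF G(1)]] by blast
  obtain T where T: "subgraph T G" "tree T" "verts T = verts G"
    using connected_graph_spanning_tree G by blast
  have "rainbow_S_tree G c S T" if "S \<subseteq> verts G" for S
    using T c that by (auto simp: rainbow_S_tree_def subgraph_def intro: inj_on_subset)
  then have ex: "?P (card (c ` edges G))"
    by (auto simp: three_rainbow_coloring_def)
  have min: "2 \<le> k" if "?P k" for k
  proof -
    obtain S where "S \<subseteq> verts G" "card S = 3"
      using G(3) by (rule obtain_subset_with_card_n)
    then show ?thesis
      using that rainbow_S_treeD(4,5)[OF G(1)] unfolding three_rainbow_coloring_def
      by (metis order_trans)
  qed
  have "rx3 G = 2 \<longleftrightarrow> ?P 2"
    unfolding rx3_def using LeastI[of ?P, OF ex] Least_equality[of ?P 2] min by metis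
  moreover have "three_rainbow_coloring G c \<longleftrightarrow>
      (\<forall>S. S \<subseteq> verts G \<and> card S = 3 \<longrightarrow> bicolored_path G c S)" if "card (c ` edges G) = 2" for c
    using rainbow_S_tree_two_colors_iff[OF G(1) that] by (auto simp: three_rainbow_coloring_def)
  ultimately show ?thesis by blast
qed

lemma rx3_eq_2I:
  assumes G: "simple_graph G" "connected_graph G" "card (verts G) \<ge> 3"
    and col: "c ` edges G \<subseteq> {0, 1}"
    and paths: "\<And>S. S \<subseteq> verts G \<Longrightarrow> card S = 3 \<Longrightarrow> bicolored_path G c S"
  shows "rx3 G = 2"
proof -
  obtain S where "S \<subseteq> verts G" "card S = 3"
    using G(3) by (rule obtain_subset_with_card_n)
  then have "bicolored_path G c S" by (rule paths)
  then obtain e f where "e \<in> edges G" "f \<in> edges G" "c e \<noteq> c f"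
    unfolding bicolored_path_def by blast
  moreover from this have "c e \<in> {0, 1}" "c f \<in> {0, 1}" using col by blast+
  ultimately have "{c e, c f} = {0, 1}" "{c e, c f} \<subseteq> c ` edges G" by auto
  then have "c ` edges G = {0, 1}" using col by (metis subset_antisym)
  then have "card (c ` edges G) = 2" by simp
  then show ?thesis using rx3_eq_2_iff[OF G] paths by blast
qed

section \<open>At most five vertices\<close>

text \<open>The vertices not joined to \<open>v\<close> by \<open>A\<close> are pairwise joined by \<open>A\<close>, since each pair of them
  forms a triple with \<open>v\<close>; three of them would form a triple missing \<open>B\<close>.\<close>

lemma card_class_non_neighbors_le_2:
  assumes A: "\<And>x y z. x \<in> V \<Longrightarrow> y \<in> V \<Longrightarrow> z \<in> V \<Longrightarrow> distinct [x, y, z] \<Longrightarrow>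
      {x, y} \<in> A \<or> {y, z} \<in> A \<or> {x, z} \<in> A"
    and B: "\<And>x y z. x \<in> V \<Longrightarrow> y \<in> V \<Longrightarrow> z \<in> V \<Longrightarrow> distinct [x, y, z] \<Longrightarrow>
      {x, y} \<in> B \<or> {y, z} \<in> B \<or> {x, z} \<in> B"
    and AB: "A \<inter> B = {}" and v: "v \<in> V"
  shows "card {x \<in> V - {v}. {v, x} \<notin> A} \<le> 2" (is "card ?N \<le> 2")
proof (rule ccontr)
  assume "\<not> ?thesis"
  then have "3 \<le> card ?N" by simp
  then obtain S where "S \<subseteq> ?N" "card S = 3" by (rule obtain_subset_with_card_n)
  moreover obtain x y z where "S = {x, y, z}" and d: "distinct [x, y, z]"
    using \<open>card S = 3\<close> by (auto simp: card_3_iff)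
  ultimately have N: "x \<in> ?N" "y \<in> ?N" "z \<in> ?N" by blast+
  have "{x, y} \<in> A" "{y, z} \<in> A" "{x, z} \<in> A"
    using A[of v x y] A[of v y z] A[of v x z] N d v by auto
  then show False using B[of x y z] N d AB by auto
qed

lemma order_le_5_and_complete:
  assumes G: "simple_graph G" and col: "card (c ` edges G) = 2"
    and paths: "\<And>S. S \<subseteq> verts G \<Longrightarrow> card S = 3 \<Longrightarrow> bicolored_path G c S"
    and n: "card (verts G) \<ge> 5"
  shows "card (verts G) = 5 \<and> (\<forall>u\<in>verts G. \<forall>v\<in>verts G. u \<noteq> v \<longrightarrow> {u, v} \<in> edges G)"
proof -
  have fin: "finite (verts G)" using G by (simp add: simple_graph_def)
  obtain p q where pq: "c ` edges G = {p, q}" "p \<noteq> q" using col by (auto simp: card_2_iff)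
  define A where "A = {e \<in> edges G. c e = p}"
  define B where "B = {e \<in> edges G. c e = q}"
  have AB: "A \<inter> B = {}" using pq by (auto simp: A_def B_def)
  have both: "({x, y} \<in> A \<or> {y, z} \<in> A \<or> {x, z} \<in> A) \<and> ({x, y} \<in> B \<or> {y, z} \<in> B \<or> {x, z} \<in> B)"
    if xyz: "x \<in> verts G" "y \<in> verts G" "z \<in> verts G" "distinct [x, y, z]" for x y z
  proof -
    have "bicolored_path G c {x, y, z}" using xyz by (intro paths) auto
    then obtain a b d where S: "{x, y, z} = {a, b, d}" "distinct [a, b, d]"
      and e: "{a, b} \<in> edges G" "{b, d} \<in> edges G" "c {a, b} \<noteq> c {b, d}"
      unfolding bicolored_path_def by blast
    have "c {a, b} \<in> {p, q}" "c {b, d} \<in> {p, q}" using e pq by blast+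
    then have *: "{a, b} \<in> A \<and> {b, d} \<in> B \<or> {a, b} \<in> B \<and> {b, d} \<in> A"
      using e by (auto simp: A_def B_def)
    have "{a, b} \<in> {{x, y}, {y, z}, {x, z}}" "{b, d} \<in> {{x, y}, {y, z}, {x, z}}"
    proof -
      have "a \<in> {x, y, z}" "b \<in> {x, y, z}" "d \<in> {x, y, z}" using S(1) by blast+
      then show "{a, b} \<in> {{x, y}, {y, z}, {x, z}}" "{b, d} \<in> {{x, y}, {y, z}, {x, z}}"
        using S(2) by (auto simp: insert_commute)
    qed
    with * show ?thesis by auto
  qed
  \<comment> \<open>The two sets of non-neighbors of \<open>v\<close> cover the other vertices and intersect in the vertices
    not adjacent to \<open>v\<close>; with at least four other vertices, both bounds are attained and the
    intersection is empty.\<close>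
  have step: "card (verts G) = 5 \<and> (\<forall>u\<in>verts G. u \<noteq> v \<longrightarrow> {v, u} \<in> edges G)" if v: "v \<in> verts G" for v
  proof -
    let ?NA = "{x \<in> verts G - {v}. {v, x} \<notin> A}" and ?NB = "{x \<in> verts G - {v}. {v, x} \<notin> B}"
    have "card ?NA \<le> 2"
      by (rule card_class_non_neighbors_le_2[where B = B]) (use both AB v in auto)
    moreover have "card ?NB \<le> 2"
      by (rule card_class_non_neighbors_le_2[where B = A]) (use both AB v in auto)
    moreover have "card ?NA + card ?NB = card (?NA \<union> ?NB) + card (?NA \<inter> ?NB)"
      using fin by (intro card_Un_Int) auto
    moreover have "?NA \<union> ?NB = verts G - {v}" using AB by auto
    then have "card (?NA \<union> ?NB) = card (verts G) - 1" using v by simp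
    ultimately have "card (verts G) = 5" "card (?NA \<inter> ?NB) = 0" using n by linarith+
    then have "?NA \<inter> ?NB = {}" using fin by simp
    then have "{v, u} \<in> edges G" if "u \<in> verts G" "u \<noteq> v" for u
      using that by (auto simp: A_def B_def)
    with \<open>card (verts G) = 5\<close> show ?thesis by blast
  qed
  obtain v where "v \<in> verts G" using n by fastforce
  then have "card (verts G) = 5" using step by blast
  moreover have "{u, v} \<in> edges G" if "u \<in> verts G" "v \<in> verts G" "u \<noteq> v" for u v
    using step[OF that(1)] that(2,3) by metis
  ultimately show ?thesis by blast
qed

lemma graph_isomorphic_complete_graph_iff:
  assumes "simple_graph G"
  shows "graph_isomorphic G (complete_graph n) \<longleftrightarrow>
    card (verts G) = n \<and> (\<forall>u\<in>verts G. \<forall>v\<in>verts G. u \<noteq> v \<longrightarrow> {u, v} \<in> edges G)"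
proof -
  have fin: "finite (verts G)" using assms by (simp add: simple_graph_def)
  have irr: "\<not> adjacent G u u" for u by (rule simple_graph_not_adjacent_self[OF assms])
  have K: "adjacent (complete_graph n) i j \<longleftrightarrow> i < n \<and> j < n \<and> i \<noteq> j" for i j
    by (auto simp: adjacent_def complete_graph_def card_2_iff doubleton_eq_iff)
  have V: "verts (complete_graph n) = {0..<n}" by (simp add: complete_graph_def)
  show ?thesis
  proof
    assume "graph_isomorphic G (complete_graph n)"
    then obtain f where f: "bij_betw f (verts G) {0..<n}"
      and a: "\<And>u v. u \<in> verts G \<Longrightarrow> v \<in> verts G \<Longrightarrow>
        adjacent G u v \<longleftrightarrow> adjacent (complete_graph n) (f u) (f v)"
      by (auto simp: graph_isomorphic_def V)
    have "card (verts G) = n" using bij_betw_same_card[OF f] by simp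
    moreover have "{u, v} \<in> edges G" if "u \<in> verts G" "v \<in> verts G" "u \<noteq> v" for u v
    proof -
      have "f u < n" "f v < n" "f u \<noteq> f v"
        using f that by (auto simp: bij_betw_def inj_on_def)
      then show ?thesis using a[of u v] that K by (simp add: adjacent_def)
    qed
    ultimately show "card (verts G) = n \<and> (\<forall>u\<in>verts G. \<forall>v\<in>verts G. u \<noteq> v \<longrightarrow> {u, v} \<in> edges G)"
      by blast
  next
    assume R: "card (verts G) = n \<and> (\<forall>u\<in>verts G. \<forall>v\<in>verts G. u \<noteq> v \<longrightarrow> {u, v} \<in> edges G)"
    obtain f where f: "bij_betw f (verts G) {0..<n}"
      using ex_bij_betw_finite_nat[OF fin] R by blast
    have "adjacent G u v \<longleftrightarrow> adjacent (complete_graph n) (f u) (f v)"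
      if "u \<in> verts G" "v \<in> verts G" for u v
    proof -
      have "f u < n" "f v < n" "f u = f v \<longleftrightarrow> u = v"
        using f that by (auto simp: bij_betw_def inj_on_def)
      then show ?thesis using R K irr that by (auto simp: adjacent_def)
    qed
    then show "graph_isomorphic G (complete_graph n)"
      using f by (auto simp: graph_isomorphic_def V)
  qed
qed

section \<open>The coloring of the complete graph of order five\<close>

text \<open>The pairs off a pentagon form a pentagram, which is again a cycle of length five.  Neither
  contains a triangle, so every triple has two sides of different colors.\<close>

lemma rx3_complete_order_5:
  assumes G: "simple_graph G" "connected_graph G" "card (verts G) = 5"
    and K: "\<And>u v. u \<in> verts G \<Longrightarrow> v \<in> verts G \<Longrightarrow> u \<noteq> v \<Longrightarrow> {u, v} \<in> edges G"
  shows "rx3 G = 2"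
proof -
  obtain a b c d e where V: "verts G = {a, b, c, d, e}" and dist: "distinct [a, b, c, d, e]"
  proof -
    obtain xs where xs: "set xs = verts G" "distinct xs" "length xs = 5"
      using finite_distinct_list[of "verts G"] G by (metis distinct_card simple_graph_def)
    then obtain a b c d e where "xs = [a, b, c, d, e]"
      by (auto simp: eval_nat_numeral length_Suc_conv)
    then show thesis using that[of a b c d e] xs(2) xs(1)[symmetric] by simp
  qed
  have ne: "a \<noteq> b" "a \<noteq> c" "a \<noteq> d" "a \<noteq> e" "b \<noteq> c" "b \<noteq> d" "b \<noteq> e"
    "c \<noteq> d" "c \<noteq> e" "d \<noteq> e"
    using dist by simp_all
  define P where "P = {{a, b}, {b, c}, {c, d}, {d, e}, {e, a}}"
  define col :: "'a set \<Rightarrow> nat" where "col f = (if f \<in> P then 1 else 0)" for f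
  have on_P:
    "col {a, b} = 1" "col {b, c} = 1" "col {c, d} = 1" "col {d, e} = 1" "col {e, a} = 1"
    "col {b, a} = 1" "col {c, b} = 1" "col {d, c} = 1" "col {e, d} = 1" "col {a, e} = 1"
    by (simp_all add: col_def P_def doubleton_eq_iff)
  have off_P:
    "col {a, c} = 0" "col {b, d} = 0" "col {c, e} = 0" "col {d, a} = 0" "col {e, b} = 0"
    "col {c, a} = 0" "col {d, b} = 0" "col {e, c} = 0" "col {a, d} = 0" "col {b, e} = 0"
    by (simp_all add: col_def P_def doubleton_eq_iff ne ne[symmetric])
  show ?thesis
  proof (rule rx3_eq_2I[where c = col])
    fix S assume "S \<subseteq> verts G" "card S = 3"
    then obtain x y z where S: "S = {x, y, z}"
      and xyz: "x \<in> verts G" "y \<in> verts G" "z \<in> verts G" "distinct [x, y, z]"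
      by (auto simp: card_3_iff)
    have "col {x, y} \<noteq> col {y, z} \<or> col {y, x} \<noteq> col {x, z}"
      using xyz unfolding V by (elim insertE emptyE) (simp_all add: on_P off_P)
    then show "bicolored_path G col S"
    proof
      assume "col {x, y} \<noteq> col {y, z}"
      then show ?thesis using S xyz K by (intro bicolored_pathI[of _ x y z]) auto
    next
      assume "col {y, x} \<noteq> col {x, z}"
      then show ?thesis using S xyz K by (intro bicolored_pathI[of _ y x z]) auto
    qed
  qed (use G in \<open>auto simp: col_def\<close>)
qed

section \<open>Graphs of order four\<close>

lemma delete_verts_simps [simp]:
  "verts (delete_verts G X) = verts G - X"
  "edges (delete_verts G X) = {e \<in> edges G. e \<inter> X = {}}"
  by (simp_all add: delete_verts_def)

lemma simple_graph_delete_verts: "simple_graph G \<Longrightarrow> simple_graph (delete_verts G X)"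
  by (auto simp: simple_graph_def)

lemma connected_graph_path_3:
  assumes "verts G = {x, y, z}" "{x, y} \<in> edges G" "{y, z} \<in> edges G"
  shows "connected_graph G"
  unfolding connected_graph_iff_cut
proof (intro conjI allI impI)
  fix X assume X: "X \<subseteq> verts G \<and> X \<noteq> {} \<and> X \<noteq> verts G"
  then have cut: "(x \<in> X \<longleftrightarrow> y \<notin> X) \<or> (y \<in> X \<longleftrightarrow> z \<notin> X)" using assms(1) by auto
  then show "\<exists>u\<in>X. \<exists>v\<in>verts G - X. adjacent G u v"
  proof -
    have "adjacent G x y" "adjacent G y x" "adjacent G y z" "adjacent G z y"
      using assms by (simp_all add: adjacent_def insert_commute)
    moreover have "x \<in> verts G" "y \<in> verts G" "z \<in> verts G" using assms by auto
    ultimately show ?thesis using cut by blast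
  qed
qed (use assms in simp)

lemma k_connected_2_order_4I:
  assumes G: "simple_graph G" "connected_graph G" "card (verts G) = 4"
    and paths: "\<And>S. S \<subseteq> verts G \<Longrightarrow> card S = 3 \<Longrightarrow> bicolored_path G c S"
  shows "k_connected 2 G"
  unfolding k_connected_def
proof (intro conjI allI impI)
  show "card (verts G) > 2" using G by simp
  fix X assume X: "X \<subseteq> verts G \<and> card X < 2"
  have fin: "finite (verts G)" using G by (simp add: simple_graph_def)
  have "finite X" using X fin finite_subset by blast
  then consider "X = {}" | v where "X = {v}"
    using X by (metis One_nat_def card_0_eq card_1_singletonE less_2_cases)
  then show "connected_graph (delete_verts G X)"
  proof cases
    case 1
    then show ?thesis using G(2) by (cases G) (simp add: delete_verts_def)
  next
    case 2
    then have "card (verts G - X) = 3" using X G by simp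
    then have "bicolored_path G c (verts G - X)" by (intro paths) auto
    then obtain x y z where P: "verts G - X = {x, y, z}" "{x, y} \<in> edges G" "{y, z} \<in> edges G"
      unfolding bicolored_path_def by blast
    have "x \<notin> X" "y \<notin> X" "z \<notin> X" using P(1) by blast+
    then show ?thesis using P by (intro connected_graph_path_3[of _ x y z]) auto
  qed
qed

text \<open>Each triple, being what remains after deleting a vertex, contains two edges.  So no two
  non-edges meet, and some perfect matching contains them all; the other four pairs form a
  cycle.\<close>

lemma k_connected_2_order_4_cycle:
  assumes G: "simple_graph G" "k_connected 2 G" "card (verts G) = 4"
  obtains a b c d where "verts G = {a, b, c, d}" "distinct [a, b, c, d]"
    "{a, b} \<in> edges G" "{b, c} \<in> edges G" "{c, d} \<in> edges G" "{d, a} \<in> edges G"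
proof -
  obtain a b c d where V: "verts G = {a, b, c, d}" and dist: "distinct [a, b, c, d]"
  proof -
    obtain xs where xs: "set xs = verts G" "distinct xs" "length xs = 4"
      using finite_distinct_list[of "verts G"] G by (metis distinct_card simple_graph_def)
    then obtain a b c d where "xs = [a, b, c, d]"
      by (auto simp: eval_nat_numeral length_Suc_conv)
    then show thesis using that[of a b c d] xs(2) xs(1)[symmetric] by simp
  qed
  have triple: "{x, y} \<in> edges G \<and> {y, z} \<in> edges G \<or> {x, y} \<in> edges G \<and> {x, z} \<in> edges G \<or>
      {x, z} \<in> edges G \<and> {y, z} \<in> edges G"
    if v: "v \<in> verts G" and xyz: "verts G - {v} = {x, y, z}" "distinct [x, y, z]" for v x y z
  proof -
    have card: "card (verts (delete_verts G {v})) = 3" using v G(3) by simp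
    have con: "connected_graph (delete_verts G {v})"
      using G(2) v by (simp add: k_connected_def)
    obtain p q r where "verts (delete_verts G {v}) = {p, q, r}" "distinct [p, q, r]"
        "{p, q} \<in> edges (delete_verts G {v})" "{q, r} \<in> edges (delete_verts G {v})"
      by (rule connected_graph_order_3[OF simple_graph_delete_verts[OF G(1)] con card])
    then have pqr: "{p, q, r} = {x, y, z}" "distinct [p, q, r]"
        "{p, q} \<in> edges G" "{q, r} \<in> edges G"
      using xyz by auto
    have "p \<in> {x, y, z}" "q \<in> {x, y, z}" "r \<in> {x, y, z}" using pqr(1) by blast+
    then show ?thesis using pqr(2-4) by (auto simp: insert_commute)
  qed
  have "{a, b} \<in> edges G \<and> {b, c} \<in> edges G \<or> {a, b} \<in> edges G \<and> {a, c} \<in> edges G \<or>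
      {a, c} \<in> edges G \<and> {b, c} \<in> edges G"
    by (rule triple[of d]) (use V dist in auto)
  moreover have "{a, b} \<in> edges G \<and> {b, d} \<in> edges G \<or> {a, b} \<in> edges G \<and> {a, d} \<in> edges G \<or>
      {a, d} \<in> edges G \<and> {b, d} \<in> edges G"
    by (rule triple[of c]) (use V dist in auto)
  moreover have "{a, c} \<in> edges G \<and> {c, d} \<in> edges G \<or> {a, c} \<in> edges G \<and> {a, d} \<in> edges G \<or>
      {a, d} \<in> edges G \<and> {c, d} \<in> edges G"
    by (rule triple[of b]) (use V dist in auto)
  moreover have "{b, c} \<in> edges G \<and> {c, d} \<in> edges G \<or> {b, c} \<in> edges G \<and> {b, d} \<in> edges G \<or>
      {b, d} \<in> edges G \<and> {c, d} \<in> edges G"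
    by (rule triple[of a]) (use V dist in auto)
  ultimately consider
      "{a, b} \<in> edges G" "{b, c} \<in> edges G" "{c, d} \<in> edges G" "{d, a} \<in> edges G"
    | "{a, b} \<in> edges G" "{b, d} \<in> edges G" "{d, c} \<in> edges G" "{c, a} \<in> edges G"
    | "{a, c} \<in> edges G" "{c, b} \<in> edges G" "{b, d} \<in> edges G" "{d, a} \<in> edges G"
    unfolding insert_commute[of d a] insert_commute[of d c] insert_commute[of c a]
      insert_commute[of c b] by argo
  then show thesis
  proof cases
    case 1
    then show thesis using that[of a b c d] V dist by auto
  next
    case 2
    then show thesis using that[of a b d c] V dist by auto
  next
    case 3
    then show thesis using that[of a c b d] V dist by auto
  qed
qed

text \<open>Consecutive edges of the cycle get different colors.  A triple omits one vertex of the cycle,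
  and its other vertices are consecutive; edges off the cycle may have any color.\<close>

lemma rx3_order_4_cycle:
  assumes G: "simple_graph G" "connected_graph G"
    and V: "verts G = {a, b, c, d}" and dist: "distinct [a, b, c, d]"
    and E: "{a, b} \<in> edges G" "{b, c} \<in> edges G" "{c, d} \<in> edges G" "{d, a} \<in> edges G"
  shows "rx3 G = 2"
proof -
  define col :: "'a set \<Rightarrow> nat" where "col f = (if f = {a, b} \<or> f = {c, d} then 1 else 0)" for f
  show ?thesis
  proof (rule rx3_eq_2I[where c = col])
    fix S assume S: "S \<subseteq> verts G" "card S = 3"
    have "card (verts G) = 4" using V dist by simp
    then have "card (verts G - S) = 1"
      using S G(1) by (simp add: card_Diff_subset finite_subset simple_graph_def)
    then obtain w where w: "verts G - S = {w}" by (rule card_1_singletonE)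
    then have S_eq: "S = verts G - {w}" using S(1) by blast
    have "w \<in> verts G" using w by blast
    then consider "w = a" | "w = b" | "w = c" | "w = d" using V by blast
    then show "bicolored_path G col S"
    proof cases
      case 1
      show ?thesis
        by (rule bicolored_pathI[of _ b c d]) (use 1 S_eq V dist E in \<open>auto simp: col_def doubleton_eq_iff\<close>)
    next
      case 2
      show ?thesis
        by (rule bicolored_pathI[of _ c d a]) (use 2 S_eq V dist E in \<open>auto simp: col_def doubleton_eq_iff\<close>)
    next
      case 3
      show ?thesis
        by (rule bicolored_pathI[of _ d a b]) (use 3 S_eq V dist E in \<open>auto simp: col_def doubleton_eq_iff\<close>)
    next
      case 4
      show ?thesis
        by (rule bicolored_pathI[of _ a b c]) (use 4 S_eq V dist E in \<open>auto simp: col_def doubleton_eq_iff\<close>)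
    qed
  qed (use G V dist in \<open>auto simp: col_def\<close>)
qed

section \<open>The characterization\<close>

lemma rx3_order_3:
  assumes G: "simple_graph G" "connected_graph G" "card (verts G) = 3"
  shows "rx3 G = 2"
proof -
  obtain a b c where V: "verts G = {a, b, c}" and dist: "distinct [a, b, c]"
    and E: "{a, b} \<in> edges G" "{b, c} \<in> edges G"
    using connected_graph_order_3[OF G] by blast
  define col :: "'a set \<Rightarrow> nat" where "col f = (if f = {a, b} then 1 else 0)" for f
  have path: "bicolored_path G col (verts G)"
    by (rule bicolored_pathI[OF V]) (use dist E in \<open>auto simp: col_def doubleton_eq_iff\<close>)
  show ?thesis
  proof (rule rx3_eq_2I[where c = col])
    fix S assume "S \<subseteq> verts G" "card S = 3"
    then have "S = verts G" using G(3) V by (intro card_subset_eq) auto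
    then show "bicolored_path G col S" using path by simp
  qed (use G in \<open>auto simp: col_def\<close>)
qed

theorem theorem3:
  fixes G :: "'a graph"
  assumes "simple_graph G" and "connected_graph G" and "card (verts G) \<ge> 3"
  shows "rx3 G = 2 \<longleftrightarrow>
           graph_isomorphic G (complete_graph 5) \<or>
           (k_connected 2 G \<and> card (verts G) = 4) \<or>
           card (verts G) = 3"
proof
  assume "rx3 G = 2"
  then obtain c where c: "card (c ` edges G) = 2"
    and paths: "\<And>S. S \<subseteq> verts G \<Longrightarrow> card S = 3 \<Longrightarrow> bicolored_path G c S"
    using rx3_eq_2_iff[OF assms] by blast
  consider "card (verts G) = 3" | "card (verts G) = 4" | "card (verts G) \<ge> 5"
    using assms(3) by linarith
  then show "graph_isomorphic G (complete_graph 5) \<or>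
      (k_connected 2 G \<and> card (verts G) = 4) \<or> card (verts G) = 3"
  proof cases
    case 2
    then show ?thesis using k_connected_2_order_4I[OF assms(1,2) _ paths] by blast
  next
    case 3
    then show ?thesis
      using order_le_5_and_complete[OF assms(1) c paths]
        graph_isomorphic_complete_graph_iff[OF assms(1), of 5] by blast
  qed simp
next
  assume "graph_isomorphic G (complete_graph 5) \<or>
      (k_connected 2 G \<and> card (verts G) = 4) \<or> card (verts G) = 3"
  then consider "graph_isomorphic G (complete_graph 5)"
    | "k_connected 2 G" "card (verts G) = 4" | "card (verts G) = 3" by blast
  then show "rx3 G = 2"
  proof cases
    case 1
    then show ?thesis
      using graph_isomorphic_complete_graph_iff[OF assms(1), of 5]
        rx3_complete_order_5[OF assms(1,2)] by blast
  next
    case 2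
    then show ?thesis
      using k_connected_2_order_4_cycle[OF assms(1)] rx3_order_4_cycle[OF assms(1,2)] by metis
  next
    case 3
    then show ?thesis using rx3_order_3 assms by blast
  qed
qed

end
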